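(* Let $x^0\in\mathbb{R}^n$ be an observed decision which is an exact optimal solution of the forward problem $\textbf{F-DRO}(\epsilon^{\mathrm{true}})$ for some $\epsilon^{\mathrm{true}}\ge 0$, i.e. $x^0$ is the $x$-component of an optimal solution $(x^0,\tau,\lambda,s)$ of $\textbf{F-DRO}(\epsilon^{\mathrm{true}})$. Then, provided the constant $\bar\epsilon$ is sufficiently large (i.e. for all $\bar\epsilon$ exceeding some threshold), the inverse problem $\textbf{I-DRO}(x^0)$ has an optimal solution, and the optimal value $\epsilon^*$ of its variable $\epsilon$ is unique (any two optimal solutions of $\textbf{I-DRO}(x^0)$ have the same $\epsilon$-component).
   Context: Data. Positive integers $n,m,N_{oc},N_{cc},N_s$; $c\in\mathbb{R}^n$, $A\in\mathbb{R}^{N_{oc}\times n}$, $h\in\mathbb{R}^{N_{oc}}$, $B\in\mathbb{R}^{N_{cc}\times n}$, $D\in\mathbb{R}^{N_{cc}\times m}$, $d\in\mathbb{R}^{N_{cc}}$, $\gamma\in(0,1)$. The uncertain parameter $\xi$ takes values in $\Xi\subset\mathbb{R}^m$, with coordinatewise lower and upper bounds $\underline\xi=(\underline\xi_j)_{j}$ and $\overline\xi=(\overline\xi_j)_j$. The samples $\hat\xi_1,\dots,\hat\xi_{N_s}\in\Xi$ are given, and $\hat\xi_{ij}$ is the $j$-th coordinate of $\hat\xi_i$. Coefficients. $a_{0j}=0$ for all $j$ and $b_0=0$; for $k=1,\dots,N_{cc}$, $a_{kj}=D_{kj}$ and $b_k=b_k(x,\tau)=\frac1m\big((Bx-d)_k-\tau\big)$.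 Indices always range over $i=1,\dots,N_s$, $j=1,\dots,m$, $k=0,\dots,N_{cc}$ unless stated otherwise. Forward problem. For $\epsilon\ge 0$ (the radius of a Wasserstein ball), $\textbf{F-DRO}(\epsilon)$ is the problem of minimizing $c^\top x$ over $x\in\mathbb{R}^n$, $\tau\in\mathbb{R}$, $\lambda=(\lambda_j)\in\mathbb{R}^m$, $s=(s_{ij})\in\mathbb{R}^{N_s\times m}$ subject to (dual variables in parentheses) - $(\theta)$ $Ax\le h$; - $(\mu)$ $\tau+\frac1\gamma\sum_{j=1}^m\big(\lambda_j\epsilon+\frac1{N_s}\sum_{i=1}^{N_s}s_{ij}\big)\le 0$ (the CVaR constraint); - $(\phi^1_{ikj})$ $a_{kj}\hat\xi_{ij}+b_k-s_{ij}\le 0$; - $(\phi^2_{ikj})$ $a_{kj}\overline\xi_j+b_k-\lambda_j|\overline\xi_j-\hat\xi_{ij}|-s_{ij}\le 0$; - $(\phi^3_{ikj})$ $a_{kj}\underline\xi_j+b_k-\lambda_j|\underline\xi_j-\hat\xi_{ij}|-s_{ij}\le 0$; - $(\eta_j)$ $\lambda_j\ge 0$. KKT conditions of $\textbf{F-DRO}(\epsilon)$. Primal feasibility (the constraints above); dual feasibility $\theta,\mu,\phi^1_{ikj},\phi^2_{ikj},\phi^3_{ikj},\eta_j\ge 0$; stationarity: - $c+A^\top\theta+\sum_{i,j,k}(\phi^1_{ikj}+\phi^2_{ikj}+\phi^3_{ikj})\,\partial b_k/\partial x=0$; - $\mu-\frac1m\sum_{i,j}\sum_{k=1}^{N_{cc}}(\phi^1_{ikj}+\phi^2_{ikj}+\phi^3_{ikj})=0$;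 - $\frac{\mu\epsilon}{\gamma}-\sum_{i,k}\big(\phi^2_{ikj}|\overline\xi_j-\hat\xi_{ij}|+\phi^3_{ikj}|\underline\xi_j-\hat\xi_{ij}|\big)-\eta_j=0$ for all $j$; - $\frac{\mu}{\gamma N_s}-\sum_{k}(\phi^1_{ikj}+\phi^2_{ikj}+\phi^3_{ikj})=0$ for all $i,j$; and complementary slackness: the product of each dual variable with the (signed) slack of its constraint vanishes, i.e. $\theta^\top(Ax-h)=0$, $\mu\big(\tau+\frac1\gamma\sum_j(\lambda_j\epsilon+\frac1{N_s}\sum_i s_{ij})\big)=0$, $\phi^1_{ikj}(a_{kj}\hat\xi_{ij}+b_k-s_{ij})=0$, $\phi^2_{ikj}(a_{kj}\overline\xi_j+b_k-\lambda_j|\overline\xi_j-\hat\xi_{ij}|-s_{ij})=0$, $\phi^3_{ikj}(a_{kj}\underline\xi_j+b_k-\lambda_j|\underline\xi_j-\hat\xi_{ij}|-s_{ij})=0$, $\eta_j\lambda_j=0$. Inverse problem. Given $x^0\in\mathbb{R}^n$ and a constant $\bar\epsilon>0$ serving as upper bound for $\epsilon$, $\textbf{I-DRO}(x^0)$ is the problem of minimizing $|\epsilon-\bar\epsilon|$ over $\epsilon\in[0,\bar\epsilon]$, primal variables $(x,\tau,\lambda,s)$ and dual variables $(\theta,\mu,\phi^1,\phi^2,\phi^3,\eta)$, subject to all the KKT conditions of $\textbf{F-DRO}(\epsilon)$ and $x=x^0$ (the other primal variables and the dual variables are free). *)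

theory Defs
  imports "HOL-Analysis.Analysis"
begin

text \<open>
  Dimensions are given by finite (hence nonempty) index types: \<open>'n\<close> for the decision
  (\<open>CARD('n) = n\<close>), \<open>'m\<close> for the uncertain parameter, \<open>'oc\<close> and \<open>'cc\<close> for the ordinary
  and the chance constraints, \<open>'s\<close> for the samples. The index \<open>k = 0, \<dots>, N\<^sub>c\<^sub>c\<close> ranges over
  \<open>'cc option\<close>: \<open>None\<close> is \<open>k = 0\<close> and \<open>Some k\<close> is the chance constraint \<open>k\<close>.
\<close>

record ('n, 'm, 'oc, 'cc, 's) dro_data =
  cvec :: "real ^ 'n::finite"
  Amat :: "real ^ 'n ^ 'oc::finite"
  hvec :: "real ^ 'oc"
  Bmat :: "real ^ 'n ^ 'cc::finite"
  Dmat :: "real ^ 'm::finite ^ 'cc"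
  dvec :: "real ^ 'cc"
  gam :: real
  supp :: "(real ^ 'm) set"
  xi_lo :: "real ^ 'm"
  xi_up :: "real ^ 'm"
  xi_hat :: "real ^ 'm ^ 's::finite"

definition valid_data ::
  "('n::finite, 'm::finite, 'oc::finite, 'cc::finite, 's::finite) dro_data \<Rightarrow> bool" where
  "valid_data P \<longleftrightarrow>
     0 < gam P \<and> gam P < 1 \<and>
     (\<forall>\<xi>\<in>supp P. \<forall>j. xi_lo P $ j \<le> \<xi> $ j \<and> \<xi> $ j \<le> xi_up P $ j) \<and>
     (\<forall>i. xi_hat P $ i \<in> supp P)"

record ('n, 'm, 's) primal_vars =
  x_of :: "real ^ 'n::finite"
  tau_of :: real
  lam_of :: "real ^ 'm::finite"
  s_of :: "real ^ 'm ^ 's::finite"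

text \<open>The multipliers \<open>phi1_of\<close>, \<open>phi2_of\<close>, \<open>phi3_of\<close> take their indices in the order \<open>i k j\<close>.\<close>

record ('m, 'oc, 'cc, 's) dual_vars =
  theta_of :: "real ^ 'oc::finite"
  mu_of :: real
  phi1_of :: "'s::finite \<Rightarrow> 'cc::finite option \<Rightarrow> 'm::finite \<Rightarrow> real"
  phi2_of :: "'s \<Rightarrow> 'cc option \<Rightarrow> 'm \<Rightarrow> real"
  phi3_of :: "'s \<Rightarrow> 'cc option \<Rightarrow> 'm \<Rightarrow> real"
  eta_of :: "real ^ 'm"

definition a_coef ::
  "('n::finite, 'm::finite, 'oc::finite, 'cc::finite, 's::finite) dro_data
     \<Rightarrow> 'cc option \<Rightarrow> 'm \<Rightarrow> real" where
  "a_coef P k j = (case k of None \<Rightarrow> 0 | Some k' \<Rightarrow> Dmat P $ k' $ j)"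

definition b_coef ::
  "('n::finite, 'm::finite, 'oc::finite, 'cc::finite, 's::finite) dro_data
     \<Rightarrow> real ^ 'n \<Rightarrow> real \<Rightarrow> 'cc option \<Rightarrow> real" where
  "b_coef P x \<tau> k =
     (case k of None \<Rightarrow> 0
      | Some k' \<Rightarrow> 1 / real CARD('m) * ((Bmat P *v x - dvec P) $ k' - \<tau>))"

definition db_dx ::
  "('n::finite, 'm::finite, 'oc::finite, 'cc::finite, 's::finite) dro_data
     \<Rightarrow> 'cc option \<Rightarrow> real ^ 'n" where
  "db_dx P k = (case k of None \<Rightarrow> 0 | Some k' \<Rightarrow> (1 / real CARD('m)) *\<^sub>R row k' (Bmat P))"

lemma GDERIV_b_coef:
  fixes P :: "('n::finite, 'm::finite, 'oc::finite, 'cc::finite, 's::finite) dro_data"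
  shows "GDERIV (\<lambda>x. b_coef P x \<tau> k) x :> db_dx P k"
proof (cases k)
  case None
  then show ?thesis by (simp add: b_coef_def db_dx_def GDERIV_const)
next
  case (Some k')
  have *: "(Bmat P *v y) $ k' = y \<bullet> row k' (Bmat P)" for y
    by (simp add: matrix_vector_mult_def row_def inner_vec_def mult.commute)
  show ?thesis
    unfolding gderiv_def Some b_coef_def db_dx_def option.case vector_minus_component *
    by (auto intro!: derivative_eq_intros simp: divide_simps)
qed

text \<open>Signed slacks (left-hand side minus right-hand side) of the scalar constraints.\<close>

definition cvar_slack ::
  "('n::finite, 'm::finite, 'oc::finite, 'cc::finite, 's::finite) dro_data
     \<Rightarrow> real \<Rightarrow> ('n, 'm, 's) primal_vars \<Rightarrow> real" where
  "cvar_slack P \<epsilon> p =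
     tau_of p + 1 / gam P *
       (\<Sum>j\<in>UNIV. lam_of p $ j * \<epsilon> + 1 / real CARD('s) * (\<Sum>i\<in>UNIV. s_of p $ i $ j))"

definition slack1 ::
  "('n::finite, 'm::finite, 'oc::finite, 'cc::finite, 's::finite) dro_data
     \<Rightarrow> ('n, 'm, 's) primal_vars \<Rightarrow> 's \<Rightarrow> 'cc option \<Rightarrow> 'm \<Rightarrow> real" where
  "slack1 P p i k j =
     a_coef P k j * xi_hat P $ i $ j + b_coef P (x_of p) (tau_of p) k - s_of p $ i $ j"

definition slack2 ::
  "('n::finite, 'm::finite, 'oc::finite, 'cc::finite, 's::finite) dro_data
     \<Rightarrow> ('n, 'm, 's) primal_vars \<Rightarrow> 's \<Rightarrow> 'cc option \<Rightarrow> 'm \<Rightarrow> real" where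
  "slack2 P p i k j =
     a_coef P k j * xi_up P $ j + b_coef P (x_of p) (tau_of p) k
       - lam_of p $ j * \<bar>xi_up P $ j - xi_hat P $ i $ j\<bar> - s_of p $ i $ j"

definition slack3 ::
  "('n::finite, 'm::finite, 'oc::finite, 'cc::finite, 's::finite) dro_data
     \<Rightarrow> ('n, 'm, 's) primal_vars \<Rightarrow> 's \<Rightarrow> 'cc option \<Rightarrow> 'm \<Rightarrow> real" where
  "slack3 P p i k j =
     a_coef P k j * xi_lo P $ j + b_coef P (x_of p) (tau_of p) k
       - lam_of p $ j * \<bar>xi_lo P $ j - xi_hat P $ i $ j\<bar> - s_of p $ i $ j"

definition FDRO_feasible ::
  "('n::finite, 'm::finite, 'oc::finite, 'cc::finite, 's::finite) dro_data
     \<Rightarrow> real \<Rightarrow> ('n, 'm, 's) primal_vars \<Rightarrow> bool" where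
  "FDRO_feasible P \<epsilon> p \<longleftrightarrow>
     (\<forall>l. (Amat P *v x_of p) $ l \<le> hvec P $ l) \<and>
     cvar_slack P \<epsilon> p \<le> 0 \<and>
     (\<forall>i k j. slack1 P p i k j \<le> 0) \<and>
     (\<forall>i k j. slack2 P p i k j \<le> 0) \<and>
     (\<forall>i k j. slack3 P p i k j \<le> 0) \<and>
     (\<forall>j. 0 \<le> lam_of p $ j)"

definition FDRO_optimal ::
  "('n::finite, 'm::finite, 'oc::finite, 'cc::finite, 's::finite) dro_data
     \<Rightarrow> real \<Rightarrow> ('n, 'm, 's) primal_vars \<Rightarrow> bool" where
  "FDRO_optimal P \<epsilon> = is_arg_min (\<lambda>p. cvec P \<bullet> x_of p) (FDRO_feasible P \<epsilon>)"

definition dual_feasible ::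
  "('m::finite, 'oc::finite, 'cc::finite, 's::finite) dual_vars \<Rightarrow> bool" where
  "dual_feasible q \<longleftrightarrow>
     (\<forall>l. 0 \<le> theta_of q $ l) \<and> 0 \<le> mu_of q \<and>
     (\<forall>i k j. 0 \<le> phi1_of q i k j) \<and>
     (\<forall>i k j. 0 \<le> phi2_of q i k j) \<and>
     (\<forall>i k j. 0 \<le> phi3_of q i k j) \<and>
     (\<forall>j. 0 \<le> eta_of q $ j)"

text \<open>Stationarity with respect to \<open>x\<close>, \<open>\<tau>\<close>, \<open>\<lambda>\<^sub>j\<close> and \<open>s\<^sub>i\<^sub>j\<close>, in this order.\<close>

definition stationary ::
  "('n::finite, 'm::finite, 'oc::finite, 'cc::finite, 's::finite) dro_data
     \<Rightarrow> real \<Rightarrow> ('m, 'oc, 'cc, 's) dual_vars \<Rightarrow> bool" where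
  "stationary P \<epsilon> q \<longleftrightarrow>
     cvec P + transpose (Amat P) *v theta_of q
       + (\<Sum>i\<in>UNIV. \<Sum>j\<in>UNIV. \<Sum>k\<in>UNIV.
            (phi1_of q i k j + phi2_of q i k j + phi3_of q i k j) *\<^sub>R db_dx P k) = 0 \<and>
     mu_of q - 1 / real CARD('m) *
       (\<Sum>i\<in>UNIV. \<Sum>j\<in>UNIV. \<Sum>k\<in>UNIV.
            phi1_of q i (Some k) j + phi2_of q i (Some k) j + phi3_of q i (Some k) j) = 0 \<and>
     (\<forall>j. mu_of q * \<epsilon> / gam P
       - (\<Sum>i\<in>UNIV. \<Sum>k\<in>UNIV.
            phi2_of q i k j * \<bar>xi_up P $ j - xi_hat P $ i $ j\<bar>
            + phi3_of q i k j * \<bar>xi_lo P $ j - xi_hat P $ i $ j\<bar>)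
       - eta_of q $ j = 0) \<and>
     (\<forall>i j. mu_of q / (gam P * real CARD('s))
       - (\<Sum>k\<in>UNIV. phi1_of q i k j + phi2_of q i k j + phi3_of q i k j) = 0)"

definition complementary ::
  "('n::finite, 'm::finite, 'oc::finite, 'cc::finite, 's::finite) dro_data
     \<Rightarrow> real \<Rightarrow> ('n, 'm, 's) primal_vars \<Rightarrow> ('m, 'oc, 'cc, 's) dual_vars \<Rightarrow> bool" where
  "complementary P \<epsilon> p q \<longleftrightarrow>
     theta_of q \<bullet> (Amat P *v x_of p - hvec P) = 0 \<and>
     mu_of q * cvar_slack P \<epsilon> p = 0 \<and>
     (\<forall>i k j. phi1_of q i k j * slack1 P p i k j = 0) \<and>
     (\<forall>i k j. phi2_of q i k j * slack2 P p i k j = 0) \<and>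
     (\<forall>i k j. phi3_of q i k j * slack3 P p i k j = 0) \<and>
     (\<forall>j. eta_of q $ j * lam_of p $ j = 0)"

definition FDRO_KKT ::
  "('n::finite, 'm::finite, 'oc::finite, 'cc::finite, 's::finite) dro_data
     \<Rightarrow> real \<Rightarrow> ('n, 'm, 's) primal_vars \<Rightarrow> ('m, 'oc, 'cc, 's) dual_vars \<Rightarrow> bool" where
  "FDRO_KKT P \<epsilon> p q \<longleftrightarrow>
     FDRO_feasible P \<epsilon> p \<and> dual_feasible q \<and> stationary P \<epsilon> q \<and> complementary P \<epsilon> p q"

definition IDRO_feasible ::
  "('n::finite, 'm::finite, 'oc::finite, 'cc::finite, 's::finite) dro_data
     \<Rightarrow> real \<Rightarrow> real ^ 'n
     \<Rightarrow> real \<times> ('n, 'm, 's) primal_vars \<times> ('m, 'oc, 'cc, 's) dual_vars \<Rightarrow> bool" where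
  "IDRO_feasible P \<epsilon>_bar x0 = (\<lambda>(\<epsilon>, p, q).
     0 \<le> \<epsilon> \<and> \<epsilon> \<le> \<epsilon>_bar \<and> FDRO_KKT P \<epsilon> p q \<and> x_of p = x0)"

definition IDRO_optimal ::
  "('n::finite, 'm::finite, 'oc::finite, 'cc::finite, 's::finite) dro_data
     \<Rightarrow> real \<Rightarrow> real ^ 'n
     \<Rightarrow> real \<times> ('n, 'm, 's) primal_vars \<times> ('m, 'oc, 'cc, 's) dual_vars \<Rightarrow> bool" where
  "IDRO_optimal P \<epsilon>_bar x0 =
     is_arg_min (\<lambda>(\<epsilon>, p, q). \<bar>\<epsilon> - \<epsilon>_bar\<bar>) (IDRO_feasible P \<epsilon>_bar x0)"

end

theory Submission
  imports Defs
begin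

text \<open>
  As \<open>\<lambda> \<ge> 0\<close>, the feasible set of F-DRO shrinks as \<open>\<epsilon>\<close> grows. So if \<open>x0\<close> is optimal at
  \<open>\<epsilon>_true\<close>, it is optimal at every larger radius at which it is still feasible, and linear
  programming duality supplies the multipliers there. For \<open>\<epsilon>_bar > \<epsilon>_true\<close> the inverse problem
  therefore asks for the largest \<open>\<epsilon> \<le> \<epsilon>_bar\<close> at which \<open>x0\<close> is feasible, which is unique if
  it exists. Existence is a compactness argument: the constraints with \<open>k = 0\<close> give \<open>s \<ge> 0\<close>,
  those with \<open>k \<ge> 1\<close> together with \<open>\<gamma> < 1\<close> bound \<open>\<tau>\<close> from below, and then the CVaR constraint
  bounds \<open>s\<close> and \<open>\<lambda>\<^sub>j \<epsilon>\<close>, hence \<open>\<lambda>\<close> as long as \<open>\<epsilon>\<close> stays away from \<open>0\<close>.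
\<close>

section \<open>Multipliers for linear programs\<close>

text \<open>The nonnegative combinations of the \<open>a i\<close> form a convex cone that contains
  every generator, so the hull lies inside by minimality. This turns membership in the hull into
  explicit multipliers.\<close>

lemma finite_convex_cone_hull_subset:
  fixes a :: "'i \<Rightarrow> 'a::real_vector"
  assumes "finite J"
  shows "convex_cone hull (a ` J) \<subseteq> {\<Sum>i\<in>J. u i *\<^sub>R a i | u. \<forall>i\<in>J. 0 \<le> u i}"
proof -
  define K where "K = {\<Sum>i\<in>J. u i *\<^sub>R a i | u. \<forall>i\<in>J. 0 \<le> u i}"
  have "a ` J \<subseteq> K"
  proof (unfold K_def, clarify)
    fix i assume i: "i \<in> J"
    have "a i = (\<Sum>k\<in>J. (if k = i then 1 else 0) *\<^sub>R a k)"
      using assms i by (simp add: if_distrib[of "\<lambda>c. c *\<^sub>R _"] cong: if_cong)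
    then show "\<exists>u. a i = (\<Sum>i\<in>J. u i *\<^sub>R a i) \<and> (\<forall>i\<in>J. 0 \<le> u i)"
      by (intro exI[of _ "\<lambda>k. if k = i then 1 else 0"]) auto
  qed
  have "v + w \<in> K" if vw: "v \<in> K" "w \<in> K" for v w
  proof -
    obtain p q where "v = (\<Sum>i\<in>J. p i *\<^sub>R a i)" "\<forall>i\<in>J. 0 \<le> p i"
      "w = (\<Sum>i\<in>J. q i *\<^sub>R a i)" "\<forall>i\<in>J. 0 \<le> q i"
      using vw by (auto simp: K_def)
    then show ?thesis
      by (auto intro!: exI[of _ "\<lambda>i. p i + q i"] simp: K_def scaleR_add_left sum.distrib)
  qed
  moreover have "t *\<^sub>R v \<in> K" if v: "v \<in> K" "0 \<le> t" for v t
  proof -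
    obtain p where "v = (\<Sum>i\<in>J. p i *\<^sub>R a i)" "\<forall>i\<in>J. 0 \<le> p i"
      using v by (auto simp: K_def)
    with \<open>0 \<le> t\<close> show ?thesis
      by (auto intro!: exI[of _ "\<lambda>i. t * p i"] simp: K_def scaleR_sum_right)
  qed
  moreover have "0 \<in> K"
    by (auto simp: K_def intro!: exI[of _ "\<lambda>_. 0"])
  ultimately have "convex_cone K"
    unfolding convex_cone_iff by blast
  with \<open>a ` J \<subseteq> K\<close> show ?thesis
    unfolding K_def by (rule hull_minimal)
qed

text \<open>Farkas' argument. The cone generated by the gradients of the active constraints is
  finitely generated, hence closed, so if the negative gradient of \<open>g\<close> lay outside it,
  the two could be strictly separated. The linearity of the problem replaces any constraint
  qualification.\<close>

lemma linear_program_kkt: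
  fixes f :: "'i::finite \<Rightarrow> 'a::euclidean_space \<Rightarrow> real" and g :: "'a \<Rightarrow> real"
  assumes f: "\<And>i. linear (f i)" and g: "linear g"
    and feas: "\<And>i. f i x \<le> b i"
    and opt: "\<And>y. (\<And>i. f i y \<le> b i) \<Longrightarrow> g x \<le> g y"
  obtains u where "\<And>i. 0 \<le> u i" "\<And>d. g d + (\<Sum>i\<in>UNIV. u i * f i d) = 0"
    "\<And>i. u i * (f i x - b i) = 0"
proof -
  define J where "J = {i. f i x = b i}"
  define a where "a i = adjoint (f i) 1" for i
  define c where "c = adjoint g 1"
  have fa: "f i d = a i \<bullet> d" for i d
    using adjoint_works[OF f, of d i 1] by (simp add: a_def inner_commute)
  have gc: "g d = c \<bullet> d" for d
    using adjoint_works[OF g, of d 1] by (simp add: c_def inner_commute)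
  \<comment> \<open>Otherwise a separating direction decreases \<open>g\<close> and keeps all constraints for a short while.\<close>
  have "- c \<in> convex_cone hull (a ` J)"
  proof (rule ccontr)
    assume "- c \<notin> convex_cone hull (a ` J)"
    then obtain p \<beta> where p: "p \<bullet> (- c) < \<beta>" "\<And>z. z \<in> convex_cone hull (a ` J) \<Longrightarrow> \<beta> < p \<bullet> z"
      using separating_hyperplane_closed_point[OF convex_convex_cone_hull closed_convex_cone_hull, of "a ` J" "- c"]
      by auto
    have \<beta>: "\<beta> < 0"
      using p(2)[OF convex_cone_hull_contains_0] by simp
    have active: "0 \<le> a i \<bullet> p" if "i \<in> J" for i
    proof (rule ccontr)
      assume neg: "\<not> 0 \<le> a i \<bullet> p"
      \<comment> \<open>This multiple of \<open>a i\<close> has inner product exactly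
        \<open>\<beta>\<close> with \<open>p\<close>, which contradicts the strict separation; its
        coefficient is a quotient of two negative numbers.\<close>
      have "(\<beta> / (a i \<bullet> p)) *\<^sub>R a i \<in> convex_cone hull (a ` J)"
        using that neg \<beta> by (intro convex_cone_hull_mul hull_inc) (auto simp: divide_nonpos_neg)
      from p(2)[OF this] neg show False
        by (simp add: inner_commute)
    qed
    have "eventually (\<lambda>t. f i (x - t *\<^sub>R p) \<le> b i) (at_right 0)" for i
    proof (cases "i \<in> J")
      case True
      show ?thesis
        using eventually_at_right_less[of "0::real"]
      proof eventually_elim
        case (elim t)
        then show ?case
          using True active[OF True] by (simp add: fa inner_diff_right J_def)
      qed
    next
      case False
      \<comment> \<open>An inactive constraint has positive slack, and by continuity a short move
        cannot use it up.\<close>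
      with feas[of i] have "f i x < b i"
        by (simp add: J_def)
      moreover have "((\<lambda>t. f i (x - t *\<^sub>R p)) \<longlongrightarrow> f i (x - 0 *\<^sub>R p)) (at_right 0)"
        unfolding fa by (intro tendsto_intros)
      ultimately show ?thesis
        by (auto dest!: order_tendstoD(2) elim: eventually_mono)
    qed
    then have "eventually (\<lambda>t. 0 < t \<and> (\<forall>i. f i (x - t *\<^sub>R p) \<le> b i)) (at_right 0)"
      by (intro eventually_conj eventually_at_right_less eventually_all_finite)
    then obtain t where t: "0 < t" "\<And>i. f i (x - t *\<^sub>R p) \<le> b i"
      using eventually_happens'[OF trivial_limit_at_right_real] by blast
    have "t * (c \<bullet> p) \<le> 0"
      using opt[OF t(2)] by (simp add: gc inner_diff_right)
    moreover have "0 < c \<bullet> p"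
      using p(1) \<beta> by (simp add: inner_commute)
    ultimately show False
      using t(1) by (simp add: mult_le_0_iff)
  qed
  then obtain v where v: "- c = (\<Sum>i\<in>J. v i *\<^sub>R a i)" "\<forall>i\<in>J. 0 \<le> v i"
    using finite_convex_cone_hull_subset[of J a] by auto
  \<comment> \<open>Extending the multipliers by zero off the active set is what yields
    complementary slackness.\<close>
  define u where "u i = (if i \<in> J then v i else 0)" for i
  show ?thesis
  proof
    show "0 \<le> u i" for i
      using v(2) by (simp add: u_def)
    show "u i * (f i x - b i) = 0" for i
      by (simp add: u_def J_def)
    have "(\<Sum>i\<in>UNIV. u i * f i d) = (- c) \<bullet> d" for d
      unfolding v(1) inner_sum_left
      by (rule sum.mono_neutral_cong_right) (auto simp: u_def fa)
    then show "g d + (\<Sum>i\<in>UNIV. u i * f i d) = 0" for d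
      by (simp add: gc)
  qed
qed


section \<open>KKT multipliers for the forward problem\<close>

lemma sum_UNIV_Plus:
  fixes h :: "'a::finite + 'b::finite \<Rightarrow> 'c::comm_monoid_add"
  shows "(\<Sum>i\<in>UNIV. h i) = (\<Sum>i\<in>UNIV. h (Inl i)) + (\<Sum>i\<in>UNIV. h (Inr i))"
  using sum.Plus[of UNIV UNIV h] by (simp add: comp_def)

lemma sum_UNIV_Times:
  fixes h :: "'a::finite \<times> 'b::finite \<Rightarrow> 'c::comm_monoid_add"
  shows "(\<Sum>i\<in>UNIV. h i) = (\<Sum>i\<in>UNIV. \<Sum>j\<in>UNIV. h (i, j))"
  unfolding UNIV_Times_UNIV[symmetric] sum.cartesian_product by simp

lemma sum_UNIV_option:
  fixes h :: "'a::finite option \<Rightarrow> 'c::comm_monoid_add"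
  shows "(\<Sum>k\<in>UNIV. h k) = h None + (\<Sum>k\<in>UNIV. h (Some k))"
  unfolding UNIV_option_conv by (subst sum.insert) (auto simp: sum.reindex)

text \<open>The linear part of the affine map \<open>b_coef\<close> in \<open>(x, \<tau>)\<close>.
  Splitting off the constant \<open>b_coef P 0 0 k\<close> brings the constraints to the form of a
  linear functional bounded by a number.\<close>

definition b_linear ::
  "('n::finite, 'm::finite, 'oc::finite, 'cc::finite, 's::finite) dro_data
     \<Rightarrow> real ^ 'n \<Rightarrow> real \<Rightarrow> 'cc option \<Rightarrow> real" where
  "b_linear P x \<tau> k =
     db_dx P k \<bullet> x - (case k of None \<Rightarrow> 0 | Some _ \<Rightarrow> \<tau> / real CARD('m))"

lemma b_coef_affine: "b_coef P x \<tau> k = b_linear P x \<tau> k + b_coef P 0 0 k"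
proof (cases k)
  case (Some k')
  have "(Bmat P *v x) $ k' = row k' (Bmat P) \<bullet> x"
    by (simp add: matrix_vector_mult_def row_def inner_vec_def)
  with Some show ?thesis
    by (simp add: b_coef_def b_linear_def db_dx_def field_simps)
qed (simp add: b_coef_def b_linear_def db_dx_def)

text \<open>The space \<open>'v\<close> stands for the remaining variables \<open>lam\<close> and
  \<open>s\<close>, on which \<open>b_linear\<close> does not depend.\<close>

lemma linear_b_linear:
  "linear (\<lambda>d :: (real ^ 'n) \<times> real \<times> 'v::real_vector.
     b_linear (P :: ('n::finite, 'm::finite, 'oc::finite, 'cc::finite, 's::finite) dro_data)
       (fst d) (fst (snd d)) k)"
  by (rule linearI; cases k)
    (simp_all add: b_linear_def add_divide_distrib algebra_simps)

text \<open>Used to evaluate the multiplier sums in the unit direction of the single coordinate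
  \<open>s $ i $ j\<close>; \<open>sum_axis\<close> does the same for
  \<open>lam $ j\<close>.\<close>

lemma sum_axis_axis:
  fixes g :: "'s::finite \<Rightarrow> 'k::finite \<Rightarrow> 'm::finite \<Rightarrow> real"
  shows "(\<Sum>i'\<in>UNIV. \<Sum>k\<in>UNIV. \<Sum>j'\<in>UNIV. g i' k j' * axis i (axis j 1) $ i' $ j') =
    (\<Sum>k\<in>UNIV. g i k j)"
proof -
  have "(\<Sum>j'\<in>UNIV. g i' k j' * axis i (axis j 1) $ i' $ j') = (if i' = i then g i k j else 0)"
    for i' k
    by (cases "i' = i") (simp_all add: axis_def if_distrib cong: if_cong)
  then show ?thesis
    by (subst sum.swap) simp
qed

lemma sum_axis:
  fixes g :: "'s::finite \<Rightarrow> 'k::finite \<Rightarrow> 'm::finite \<Rightarrow> real"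
  shows "(\<Sum>i\<in>UNIV. \<Sum>k\<in>UNIV. \<Sum>j'\<in>UNIV. g i k j' * axis j 1 $ j') =
    (\<Sum>i\<in>UNIV. \<Sum>k\<in>UNIV. g i k j)"
  by (simp add: axis_def if_distrib cong: if_cong)

text \<open>The hypothesis says that the linear part of the Lagrangian vanishes identically. Testing
  it on arbitrary \<open>x\<close> and on the unit directions of \<open>\<tau>\<close>,
  \<open>lam $ j\<close> and \<open>s $ i $ j\<close>, with all other variables zero, isolates the
  four stationarity equations.\<close>

lemma dual_combination_imp_stationary:
  fixes P :: "('n::finite, 'm::finite, 'oc::finite, 'cc::finite, 's::finite) dro_data"
    and q :: "('m, 'oc, 'cc, 's) dual_vars"
  assumes "\<And>x \<tau> lam s.
     cvec P \<bullet> x + (\<Sum>l\<in>UNIV. theta_of q $ l * (Amat P *v x) $ l)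
       + mu_of q * cvar_slack P \<epsilon> \<lparr>x_of = x, tau_of = \<tau>, lam_of = lam, s_of = s\<rparr>
       - (\<Sum>j\<in>UNIV. eta_of q $ j * lam $ j)
       + (\<Sum>i\<in>UNIV. \<Sum>k\<in>UNIV. \<Sum>j\<in>UNIV.
            phi1_of q i k j * (b_linear P x \<tau> k - s $ i $ j)
            + phi2_of q i k j * (b_linear P x \<tau> k - lam $ j * \<bar>xi_up P $ j - xi_hat P $ i $ j\<bar> - s $ i $ j)
            + phi3_of q i k j * (b_linear P x \<tau> k - lam $ j * \<bar>xi_lo P $ j - xi_hat P $ i $ j\<bar> - s $ i $ j)) = 0"
    (is "\<And>x \<tau> lam s. ?L x \<tau> lam s = 0")
  shows "stationary P \<epsilon> q"
proof -
  \<comment> \<open>The coefficients of \<open>b_linear P x \<tau> k\<close> and of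
    \<open>- lam $ j\<close> in the triple sum, collected over the three constraint
    families.\<close>
  define \<phi> where "\<phi> i k j = phi1_of q i k j + phi2_of q i k j + phi3_of q i k j" for i k j
  define \<psi> where "\<psi> i k j = phi2_of q i k j * \<bar>xi_up P $ j - xi_hat P $ i $ j\<bar>
    + phi3_of q i k j * \<bar>xi_lo P $ j - xi_hat P $ i $ j\<bar>" for i k j
  have "?L x \<tau> lam s =
     cvec P \<bullet> x + (\<Sum>l\<in>UNIV. theta_of q $ l * (Amat P *v x) $ l)
       + mu_of q * cvar_slack P \<epsilon> \<lparr>x_of = x, tau_of = \<tau>, lam_of = lam, s_of = s\<rparr>
       - (\<Sum>j\<in>UNIV. eta_of q $ j * lam $ j)
       + ((\<Sum>i\<in>UNIV. \<Sum>k\<in>UNIV. \<Sum>j\<in>UNIV. \<phi> i k j * b_linear P x \<tau> k)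
       - (\<Sum>i\<in>UNIV. \<Sum>k\<in>UNIV. \<Sum>j\<in>UNIV. \<psi> i k j * lam $ j)
       - (\<Sum>i\<in>UNIV. \<Sum>k\<in>UNIV. \<Sum>j\<in>UNIV. \<phi> i k j * s $ i $ j))" for x \<tau> lam s
    unfolding sum_subtractf[symmetric]
    by (intro arg_cong2[where f = "(+)"] refl sum.cong) (simp add: \<phi>_def \<psi>_def algebra_simps)
  with assms have L: "cvec P \<bullet> x + (\<Sum>l\<in>UNIV. theta_of q $ l * (Amat P *v x) $ l)
       + mu_of q * cvar_slack P \<epsilon> \<lparr>x_of = x, tau_of = \<tau>, lam_of = lam, s_of = s\<rparr>
       - (\<Sum>j\<in>UNIV. eta_of q $ j * lam $ j)
       + ((\<Sum>i\<in>UNIV. \<Sum>k\<in>UNIV. \<Sum>j\<in>UNIV. \<phi> i k j * b_linear P x \<tau> k)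
       - (\<Sum>i\<in>UNIV. \<Sum>k\<in>UNIV. \<Sum>j\<in>UNIV. \<psi> i k j * lam $ j)
       - (\<Sum>i\<in>UNIV. \<Sum>k\<in>UNIV. \<Sum>j\<in>UNIV. \<phi> i k j * s $ i $ j)) = 0" for x \<tau> lam s
    by simp
  define w where "w = cvec P + transpose (Amat P) *v theta_of q
       + (\<Sum>i\<in>UNIV. \<Sum>j\<in>UNIV. \<Sum>k\<in>UNIV. \<phi> i k j *\<^sub>R db_dx P k)"
  have "w \<bullet> x = 0" for x
  proof -
    have "b_linear P x 0 k = db_dx P k \<bullet> x" for k
      by (simp add: b_linear_def split: option.split)
    moreover have "(transpose (Amat P) *v theta_of q) \<bullet> x = (\<Sum>l\<in>UNIV. theta_of q $ l * (Amat P *v x) $ l)"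
      by (simp add: dot_lmul_matrix) (simp add: inner_vec_def)
    moreover have "(\<Sum>i\<in>UNIV. \<Sum>j\<in>UNIV. \<Sum>k\<in>UNIV. \<phi> i k j *\<^sub>R db_dx P k) \<bullet> x
       = (\<Sum>i\<in>UNIV. \<Sum>k\<in>UNIV. \<Sum>j\<in>UNIV. \<phi> i k j * (db_dx P k \<bullet> x))"
      by (subst sum.swap) (simp add: inner_sum_left)
    ultimately show ?thesis
      using L[of x 0 0 0] by (simp add: w_def inner_add_left cvar_slack_def)
  qed
  then have "w = 0"
    using inner_eq_zero_iff by blast
  moreover have "mu_of q - 1 / real CARD('m) *
      (\<Sum>i\<in>UNIV. \<Sum>j\<in>UNIV. \<Sum>k\<in>UNIV. \<phi> i (Some k) j) = 0"
  proof -
    \<comment> \<open>At \<open>x = 0\<close>, \<open>\<tau> = 1\<close> the term of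
      \<open>None\<close> vanishes and every \<open>Some k\<close> contributes the factor
      \<open>- 1 / CARD('m)\<close>, so only the chance constraints remain.\<close>
    have "(\<Sum>k\<in>UNIV. \<Sum>j\<in>UNIV. \<phi> i k j * b_linear P 0 1 k)
       = - (1 / real CARD('m)) * (\<Sum>j\<in>UNIV. \<Sum>k\<in>UNIV. \<phi> i (Some k) j)" for i
      by (subst sum.swap, unfold sum_distrib_left, intro sum.cong refl)
        (simp add: sum_UNIV_option b_linear_def sum_negf)
    then show ?thesis
      using L[of 0 1 0 0] by (simp add: cvar_slack_def sum_distrib_left sum_negf sum_divide_distrib)
  qed
  moreover have "mu_of q * \<epsilon> / gam P - (\<Sum>i\<in>UNIV. \<Sum>k\<in>UNIV. \<psi> i k j) - eta_of q $ j = 0" for j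
  proof -
    have "b_linear P 0 0 k = 0" for k
      by (simp add: b_linear_def split: option.split)
    moreover have "cvar_slack P \<epsilon> \<lparr>x_of = 0, tau_of = 0, lam_of = axis j 1, s_of = 0\<rparr> = \<epsilon> / gam P"
      by (simp add: cvar_slack_def axis_def if_distrib if_distribR cong: if_cong)
    moreover have "(\<Sum>j'\<in>UNIV. eta_of q $ j' * axis j 1 $ j') = eta_of q $ j"
      by (simp add: axis_def if_distrib cong: if_cong)
    ultimately show ?thesis
      using L[of 0 0 "axis j 1" 0] by (simp add: sum_axis)
  qed
  moreover have "mu_of q / (gam P * real CARD('s)) - (\<Sum>k\<in>UNIV. \<phi> i k j) = 0" for i j
  proof -
    have "b_linear P 0 0 k = 0" for k
      by (simp add: b_linear_def split: option.split)
    \<comment> \<open>The type \<open>unit\<close> serves as a dummy range for \<open>k\<close>, so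
      that \<open>sum_axis_axis\<close> also covers a plain double sum.\<close>
    moreover have "(\<Sum>i'\<in>UNIV. \<Sum>j'\<in>UNIV. axis i (axis j 1) $ i' $ j') = (1::real)"
      using sum_axis_axis[of "\<lambda>_ (_ :: unit) _. 1" i j] by (simp add: UNIV_unit)
    then have "(\<Sum>j'\<in>UNIV. \<Sum>i'\<in>UNIV. axis i (axis j 1) $ i' $ j') = (1::real)"
      by (subst sum.swap)
    then have "cvar_slack P \<epsilon> \<lparr>x_of = 0, tau_of = 0, lam_of = 0, s_of = axis i (axis j 1)\<rparr>
        = 1 / (gam P * real CARD('s))"
      by (simp add: cvar_slack_def sum_divide_distrib[symmetric])
    ultimately show ?thesis
      using L[of 0 0 0 "axis i (axis j 1)"] by (simp add: sum_axis_axis)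
  qed
  ultimately show ?thesis
    unfolding stationary_def w_def \<phi>_def \<psi>_def by blast
qed

text \<open>For a fixed radius F-DRO is a linear program, so \<open>linear_program_kkt\<close>
  applies once variables and constraints are put in its form.\<close>

lemma FDRO_optimal_imp_KKT:
  fixes P :: "('n::finite, 'm::finite, 'oc::finite, 'cc::finite, 's::finite) dro_data"
  assumes "FDRO_optimal P \<epsilon> p"
  obtains q where "FDRO_KKT P \<epsilon> p q"
proof -
  \<comment> \<open>Records carry no vector space structure, so the linear program lives on tuples
    and \<open>mk\<close> translates them back.\<close>
  define mk :: "(real ^ 'n) \<times> real \<times> (real ^ 'm) \<times> (real ^ 'm ^ 's) \<Rightarrow> ('n, 'm, 's) primal_vars"
    where "mk d = \<lparr>x_of = fst d, tau_of = fst (snd d), lam_of = fst (snd (snd d)),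
      s_of = snd (snd (snd d))\<rparr>" for d
  define \<beta> where "\<beta> d = b_linear P (x_of (mk d)) (tau_of (mk d))" for d
  define f1 where "f1 = (\<lambda>(i, k, j) d. \<beta> d k - s_of (mk d) $ i $ j)"
  define f2 where "f2 = (\<lambda>(i, k, j) d. \<beta> d k
    - lam_of (mk d) $ j * \<bar>xi_up P $ j - xi_hat P $ i $ j\<bar> - s_of (mk d) $ i $ j)"
  define f3 where "f3 = (\<lambda>(i, k, j) d. \<beta> d k
    - lam_of (mk d) $ j * \<bar>xi_lo P $ j - xi_hat P $ i $ j\<bar> - s_of (mk d) $ i $ j)"
  define b1 where "b1 = (\<lambda>(i, k, j). - (a_coef P k j * xi_hat P $ i $ j + b_coef P 0 0 k))"
  define b2 where "b2 = (\<lambda>(i :: 's, k, j). - (a_coef P k j * xi_up P $ j + b_coef P 0 0 k))"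
  define b3 where "b3 = (\<lambda>(i :: 's, k, j). - (a_coef P k j * xi_lo P $ j + b_coef P 0 0 k))"
  \<comment> \<open>One index type for all constraints, a nested sum in the order
    \<open>theta\<close>, \<open>mu\<close>, \<open>eta\<close>, \<open>phi1\<close>,
    \<open>phi2\<close>, \<open>phi3\<close>. The sign constraint on \<open>lam\<close> enters as
    \<open>- lam $ j \<le> 0\<close>.\<close>
  define f where "f = case_sum (\<lambda>l d. (Amat P *v x_of (mk d)) $ l)
    (case_sum (\<lambda>_ :: unit. \<lambda>d. cvar_slack P \<epsilon> (mk d))
    (case_sum (\<lambda>j d. - lam_of (mk d) $ j) (case_sum f1 (case_sum f2 f3))))"
  define b where "b = case_sum (\<lambda>l. hvec P $ l)
    (case_sum (\<lambda>_ :: unit. 0) (case_sum (\<lambda>_ :: 'm. 0) (case_sum b1 (case_sum b2 b3))))"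
  define d0 where "d0 = (x_of p, tau_of p, lam_of p, s_of p)"
  have slack1: "slack1 P (mk d) i k j = f1 (i, k, j) d - b1 (i, k, j)" for d i k j
    unfolding slack1_def b_coef_affine[of P "x_of (mk d)" "tau_of (mk d)"]
    by (simp add: f1_def b1_def \<beta>_def)
  have slack2: "slack2 P (mk d) i k j = f2 (i, k, j) d - b2 (i, k, j)" for d i k j
    unfolding slack2_def b_coef_affine[of P "x_of (mk d)" "tau_of (mk d)"]
    by (simp add: f2_def b2_def \<beta>_def)
  have slack3: "slack3 P (mk d) i k j = f3 (i, k, j) d - b3 (i, k, j)" for d i k j
    unfolding slack3_def b_coef_affine[of P "x_of (mk d)" "tau_of (mk d)"]
    by (simp add: f3_def b3_def \<beta>_def)
  have feasible: "FDRO_feasible P \<epsilon> (mk d) \<longleftrightarrow> (\<forall>i. f i d \<le> b i)" for d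
    by (auto simp: FDRO_feasible_def slack1 slack2 slack3 f_def b_def split_sum_all)
  have mk_d0: "mk d0 = p"
    by (simp add: mk_def d0_def)
  have opt: "FDRO_feasible P \<epsilon> p" "\<And>r. FDRO_feasible P \<epsilon> r \<Longrightarrow> cvec P \<bullet> x_of p \<le> cvec P \<bullet> x_of r"
    using assms by (auto simp: FDRO_optimal_def is_arg_min_linorder)
  have lin_mk: "linear (\<lambda>d. x_of (mk d))" "linear (\<lambda>d. lam_of (mk d) $ j)"
    "linear (\<lambda>d. s_of (mk d) $ i $ j)" for i j
    by (auto simp: mk_def intro!: linearI)
  have lin_\<beta>: "linear (\<lambda>d. \<beta> d k)" for k
    unfolding \<beta>_def mk_def by (simp add: linear_b_linear)
  have lin_cvar: "linear (\<lambda>d. cvar_slack P \<epsilon> (mk d))"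
    by (rule linearI)
      (simp_all add: cvar_slack_def mk_def sum.distrib algebra_simps sum_distrib_left)
  have lin_lam: "linear (\<lambda>d. lam_of (mk d) $ j * c)" for j c
    by (auto simp: mk_def algebra_simps intro!: linearI)
  have "linear (\<lambda>d. (Amat P *v x_of (mk d)) $ l)" for l
    by (auto simp: mk_def matrix_vector_right_distrib matrix_vector_mult_scaleR intro!: linearI)
  moreover have "linear (\<lambda>d. - lam_of (mk d) $ j)" for j
    by (intro linear_compose_neg lin_mk)
  moreover have "linear (f1 t)" "linear (f2 t)" "linear (f3 t)" for t
    by (cases t, auto simp: f1_def f2_def f3_def intro!: linear_compose_sub lin_mk lin_\<beta> lin_lam)+
  ultimately have lin: "\<forall>i. linear (f i)"
    by (simp add: split_sum_all f_def lin_cvar)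
  have "linear (\<lambda>d. cvec P \<bullet> x_of (mk d))"
    by (auto simp: mk_def inner_add_right intro!: linearI)
  moreover have "f i d0 \<le> b i" for i
    using opt(1) feasible[of d0] by (simp add: mk_d0)
  moreover have "cvec P \<bullet> x_of (mk d0) \<le> cvec P \<bullet> x_of (mk d)" if "\<And>i. f i d \<le> b i" for d
    using opt(2)[of "mk d"] feasible[of d] that by (simp add: mk_d0)
  ultimately obtain u where u: "\<And>i. 0 \<le> u i"
    "\<And>d. cvec P \<bullet> x_of (mk d) + (\<Sum>i\<in>UNIV. u i * f i d) = 0" "\<And>i. u i * (f i d0 - b i) = 0"
    using linear_program_kkt[of f "\<lambda>d. cvec P \<bullet> x_of (mk d)" d0 b] lin by blast
  define q where "q = \<lparr>theta_of = (\<chi> l. u (Inl l)), mu_of = u (Inr (Inl ())),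
    phi1_of = (\<lambda>i k j. u (Inr (Inr (Inr (Inl (i, k, j)))))),
    phi2_of = (\<lambda>i k j. u (Inr (Inr (Inr (Inr (Inl (i, k, j))))))),
    phi3_of = (\<lambda>i k j. u (Inr (Inr (Inr (Inr (Inr (i, k, j))))))),
    eta_of = (\<chi> j. u (Inr (Inr (Inl j))))\<rparr>"
  have "dual_feasible q"
    by (simp add: dual_feasible_def q_def u(1))
  moreover have "stationary P \<epsilon> q"
  proof (rule dual_combination_imp_stationary)
    fix x \<tau> lam s
    show "cvec P \<bullet> x + (\<Sum>l\<in>UNIV. theta_of q $ l * (Amat P *v x) $ l)
       + mu_of q * cvar_slack P \<epsilon> \<lparr>x_of = x, tau_of = \<tau>, lam_of = lam, s_of = s\<rparr>
       - (\<Sum>j\<in>UNIV. eta_of q $ j * lam $ j)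
       + (\<Sum>i\<in>UNIV. \<Sum>k\<in>UNIV. \<Sum>j\<in>UNIV.
            phi1_of q i k j * (b_linear P x \<tau> k - s $ i $ j)
            + phi2_of q i k j * (b_linear P x \<tau> k - lam $ j * \<bar>xi_up P $ j - xi_hat P $ i $ j\<bar> - s $ i $ j)
            + phi3_of q i k j * (b_linear P x \<tau> k - lam $ j * \<bar>xi_lo P $ j - xi_hat P $ i $ j\<bar> - s $ i $ j)) = 0"
      using u(2)[of "(x, \<tau>, lam, s)"]
      by (simp add: sum_UNIV_Plus sum_UNIV_Times UNIV_unit f_def f1_def f2_def f3_def \<beta>_def mk_def
          q_def sum.distrib sum_negf)
  qed
  moreover have "complementary P \<epsilon> p q"
    unfolding complementary_def
  proof (intro conjI allI)
    show "theta_of q \<bullet> (Amat P *v x_of p - hvec P) = 0"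
      using u(3)[of "Inl _"]
      by (auto simp: inner_vec_def q_def f_def b_def mk_d0 intro!: sum.neutral)
    show "mu_of q * cvar_slack P \<epsilon> p = 0"
      using u(3)[of "Inr (Inl ())"] by (simp add: q_def f_def b_def mk_d0)
    show "phi1_of q i k j * slack1 P p i k j = 0" for i k j
      using u(3)[of "Inr (Inr (Inr (Inl (i, k, j))))"] slack1[of d0 i k j]
      by (simp add: q_def f_def b_def mk_d0)
    show "phi2_of q i k j * slack2 P p i k j = 0" for i k j
      using u(3)[of "Inr (Inr (Inr (Inr (Inl (i, k, j)))))"] slack2[of d0 i k j]
      by (simp add: q_def f_def b_def mk_d0)
    show "phi3_of q i k j * slack3 P p i k j = 0" for i k j
      using u(3)[of "Inr (Inr (Inr (Inr (Inr (i, k, j)))))"] slack3[of d0 i k j]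
      by (simp add: q_def f_def b_def mk_d0)
    show "eta_of q $ j * lam_of p $ j = 0" for j
      using u(3)[of "Inr (Inr (Inl j))"] by (simp add: q_def f_def b_def mk_d0)
  qed
  ultimately have "FDRO_KKT P \<epsilon> p q"
    using opt(1) by (simp add: FDRO_KKT_def)
  then show ?thesis
    by (rule that)
qed

section \<open>Dependence on the radius\<close>

text \<open>The radius enters only the CVaR constraint, there through
  \<open>lam $ j * \<epsilon>\<close> with \<open>lam $ j \<ge> 0\<close> and the positive weight
  \<open>1 / gam P\<close>.\<close>

lemma FDRO_feasible_antimono:
  fixes P :: "('n::finite, 'm::finite, 'oc::finite, 'cc::finite, 's::finite) dro_data"
  assumes "FDRO_feasible P \<epsilon>' p" "\<epsilon> \<le> \<epsilon>'" "0 < gam P"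
  shows "FDRO_feasible P \<epsilon> p"
proof -
  have "cvar_slack P \<epsilon> p \<le> cvar_slack P \<epsilon>' p"
    using assms unfolding cvar_slack_def FDRO_feasible_def
    by (intro add_left_mono mult_left_mono sum_mono add_right_mono) auto
  with assms(1) show ?thesis
    unfolding FDRO_feasible_def by auto
qed

text \<open>Every competitor at the larger radius already competed at the smaller one, and the
  objective sees only the \<open>x\<close>-component. Hence \<open>p'\<close> may differ from
  \<open>p\<close> in all other variables.\<close>

lemma FDRO_optimal_raise_radius:
  fixes P :: "('n::finite, 'm::finite, 'oc::finite, 'cc::finite, 's::finite) dro_data"
  assumes "FDRO_optimal P \<epsilon> p" "\<epsilon> \<le> \<epsilon>'" "0 < gam P"
    and "FDRO_feasible P \<epsilon>' p'" "x_of p' = x_of p"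
  shows "FDRO_optimal P \<epsilon>' p'"
  using assms FDRO_feasible_antimono[of P \<epsilon>' _ \<epsilon>]
  by (auto simp: FDRO_optimal_def is_arg_min_linorder)

section \<open>A priori bounds and the largest feasible radius\<close>

text \<open>The bound is uniform in the radius. It concerns \<open>lam $ j * \<epsilon>\<close> and
  not \<open>lam $ j\<close>, because at \<open>\<epsilon> = 0\<close> nothing prevents
  \<open>lam\<close> from growing.\<close>

lemma FDRO_feasible_bounds:
  fixes P :: "('n::finite, 'm::finite, 'oc::finite, 'cc::finite, 's::finite) dro_data"
    and x0 :: "real ^ 'n"
  assumes "0 < gam P" "gam P < 1"
  obtains T where "0 \<le> T"
    "\<And>\<epsilon> p. 0 \<le> \<epsilon> \<Longrightarrow> FDRO_feasible P \<epsilon> p \<Longrightarrow> x_of p = x0 \<Longrightarrow>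
       \<bar>tau_of p\<bar> \<le> T \<and> (\<forall>j. lam_of p $ j * \<epsilon> \<le> T) \<and> (\<forall>i j. 0 \<le> s_of p $ i $ j \<and> s_of p $ i $ j \<le> T)"
proof -
  \<comment> \<open>A single chance constraint suffices to bound \<open>\<tau>\<close> from below,
    and one exists because index types are nonempty.\<close>
  fix k0 :: 'cc
  define M where "M = real CARD('m)"
  define N where "N = real CARD('s)"
  have MN: "0 < M" "1 \<le> N"
    by (auto simp: M_def N_def Suc_le_eq)
  define e where "e i j = a_coef P (Some k0) j * xi_hat P $ i $ j + b_coef P x0 0 (Some k0)" for i j
  define C where "C = (\<Sum>j\<in>UNIV. \<Sum>i\<in>UNIV. e i j)"
  define R where "R = \<bar>C\<bar> / (1 - gam P)"
  have R: "0 \<le> R" "R * (1 - gam P) = \<bar>C\<bar>"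
    using assms by (auto simp: R_def)
  show ?thesis
  proof (rule that[of "N * R"])
    show "0 \<le> N * R"
      using MN R by simp
    fix \<epsilon> and p :: "('n, 'm, 's) primal_vars"
    assume \<epsilon>: "0 \<le> \<epsilon>" and F: "FDRO_feasible P \<epsilon> p" and x: "x_of p = x0"
    define S where "S = (\<Sum>j\<in>UNIV. \<Sum>i\<in>UNIV. s_of p $ i $ j)"
    define W where "W = (\<Sum>j\<in>UNIV. lam_of p $ j * \<epsilon> + 1 / N * (\<Sum>i\<in>UNIV. s_of p $ i $ j))"
    have s: "0 \<le> s_of p $ i $ j" for i j
    proof -
      have "slack1 P p i None j \<le> 0"
        using F by (auto simp: FDRO_feasible_def)
      then show ?thesis
        by (simp add: slack1_def a_coef_def b_coef_def)
    qed
    have l: "0 \<le> lam_of p $ j * \<epsilon>" for j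
      using F \<epsilon> by (auto simp: FDRO_feasible_def)
    have cvar: "tau_of p * gam P + W \<le> 0"
    proof -
      have "tau_of p + 1 / gam P * W \<le> 0"
        using F by (simp add: FDRO_feasible_def cvar_slack_def W_def N_def)
      then show ?thesis
        using assms by (simp add: field_simps)
    qed
    have "e i j - tau_of p / M \<le> s_of p $ i $ j" for i j
    proof -
      have "slack1 P p i (Some k0) j \<le> 0"
        using F by (auto simp: FDRO_feasible_def)
      moreover have "b_coef P x0 (tau_of p) (Some k0) = b_coef P x0 0 (Some k0) - tau_of p / M"
        by (simp add: b_coef_def M_def diff_divide_distrib)
      ultimately show ?thesis
        by (simp add: slack1_def e_def x)
    qed
    then have "(\<Sum>j\<in>UNIV. \<Sum>i\<in>UNIV. e i j - tau_of p / M) \<le> S"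
      unfolding S_def by (intro sum_mono)
    \<comment> \<open>There are \<open>M * N\<close> summands \<open>tau_of p / M\<close>, which add
      up to \<open>N * tau_of p\<close>.\<close>
    then have "C - N * tau_of p \<le> S"
      using MN by (simp add: C_def sum_subtractf M_def N_def mult.commute)
    moreover have "S / N \<le> W"
      unfolding S_def W_def sum_divide_distrib by (intro sum_mono) (simp add: l sum_divide_distrib)
    ultimately have "C / N - tau_of p \<le> W"
      using MN by (simp add: field_simps)
    \<comment> \<open>\<open>W\<close> lies between \<open>C / N - tau_of p\<close> and
      \<open>- tau_of p * gam P\<close>. As \<open>gam P < 1\<close>, the terms in
      \<open>\<tau>\<close> do not cancel, and a lower bound for \<open>\<tau>\<close>
      remains.\<close>
    with cvar have "- (tau_of p) * (1 - gam P) \<le> - C / N"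
      by (simp add: algebra_simps)
    also have "\<dots> \<le> \<bar>C\<bar>"
    proof -
      have "- C / N \<le> \<bar>C\<bar> / N"
        using MN by (intro divide_right_mono) auto
      also have "\<dots> \<le> \<bar>C\<bar>"
        using MN by (simp add: divide_le_eq mult_le_cancel_left1)
      finally show ?thesis .
    qed
    also have "\<dots> = R * (1 - gam P)"
      using R by simp
    finally have \<tau>_lower: "- tau_of p \<le> R"
      by (rule mult_right_le_imp_le) (use assms in simp)
    have "0 \<le> W"
      unfolding W_def using l s MN by (auto intro!: sum_nonneg add_nonneg_nonneg divide_nonneg_nonneg)
    with cvar have "tau_of p * gam P \<le> 0"
      by linarith
    with assms have \<tau>_upper: "tau_of p \<le> 0"
      by (simp add: mult_le_0_iff)
    have W_le: "W \<le> R"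
    proof -
      have "W \<le> (- tau_of p) * gam P"
        using cvar by simp
      also have "\<dots> \<le> (- tau_of p) * 1"
        using assms \<tau>_upper by (intro mult_left_mono) auto
      finally show ?thesis
        using \<tau>_lower by simp
    qed
    have RN: "R \<le> N * R"
      using MN R by (simp add: mult_le_cancel_right1)
    have col: "lam_of p $ j * \<epsilon> + 1 / N * (\<Sum>i\<in>UNIV. s_of p $ i $ j) \<le> R" for j
    proof -
      have "lam_of p $ j * \<epsilon> + 1 / N * (\<Sum>i\<in>UNIV. s_of p $ i $ j) \<le> W"
        unfolding W_def using l s MN
        by (intro member_le_sum) (auto intro!: add_nonneg_nonneg divide_nonneg_nonneg sum_nonneg)
      with W_le show ?thesis by simp
    qed
    have "lam_of p $ j * \<epsilon> \<le> N * R" for j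
    proof -
      have "0 \<le> 1 / N * (\<Sum>i\<in>UNIV. s_of p $ i $ j)"
        using s MN by (intro mult_nonneg_nonneg sum_nonneg) auto
      with col[of j] RN show ?thesis by linarith
    qed
    moreover have "s_of p $ i $ j \<le> N * R" for i j
    proof -
      have "s_of p $ i $ j \<le> (\<Sum>i\<in>UNIV. s_of p $ i $ j)"
        using s by (intro member_le_sum) auto
      also have "1 / N * (\<Sum>i\<in>UNIV. s_of p $ i $ j) \<le> R"
        using col[of j] l[of j] by linarith
      then have "(\<Sum>i\<in>UNIV. s_of p $ i $ j) \<le> N * R"
        using MN by (simp add: field_simps)
      finally show ?thesis .
    qed
    ultimately show "\<bar>tau_of p\<bar> \<le> N * R \<and> (\<forall>j. lam_of p $ j * \<epsilon> \<le> N * R) \<and>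
        (\<forall>i j. 0 \<le> s_of p $ i $ j \<and> s_of p $ i $ j \<le> N * R)"
      using s \<tau>_lower \<tau>_upper RN by auto
  qed
qed

text \<open>If no positive radius up to \<open>R\<close> is feasible for \<open>x0\<close>, the
  maximum is \<open>0\<close>. Otherwise radii below some feasible \<open>\<epsilon>0 > 0\<close>
  can be discarded, and on the rest \<open>T / \<epsilon>0\<close> bounds \<open>lam\<close>, so the
  maximum is attained by compactness.\<close>

lemma FDRO_feasible_max_radius:
  fixes P :: "('n::finite, 'm::finite, 'oc::finite, 'cc::finite, 's::finite) dro_data"
    and x0 :: "real ^ 'n"
  assumes gam: "0 < gam P" "gam P < 1"
    and r: "0 \<le> r" "r \<le> R" and ex: "\<exists>p. FDRO_feasible P r p \<and> x_of p = x0"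
  obtains \<epsilon> p where "0 \<le> \<epsilon>" "\<epsilon> \<le> R" "FDRO_feasible P \<epsilon> p" "x_of p = x0"
    "\<And>\<epsilon>' p'. \<epsilon>' \<le> R \<Longrightarrow> FDRO_feasible P \<epsilon>' p' \<Longrightarrow> x_of p' = x0 \<Longrightarrow> \<epsilon>' \<le> \<epsilon>"
proof (cases "\<exists>\<epsilon>0>0. \<epsilon>0 \<le> R \<and> (\<exists>p. FDRO_feasible P \<epsilon>0 p \<and> x_of p = x0)")
  case False
  obtain p where p: "FDRO_feasible P r p" "x_of p = x0"
    using ex by blast
  have "FDRO_feasible P 0 p"
    using p gam r by (intro FDRO_feasible_antimono[of P r p 0]) auto
  moreover have "\<epsilon>' \<le> 0" if "\<epsilon>' \<le> R" "FDRO_feasible P \<epsilon>' p'" "x_of p' = x0" for \<epsilon>' p'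
    using False that by force
  ultimately show ?thesis
    using that[of 0 p] p r by auto
next
  case True
  then obtain \<epsilon>0 p0 where 0: "0 < \<epsilon>0" "\<epsilon>0 \<le> R" "FDRO_feasible P \<epsilon>0 p0" "x_of p0 = x0"
    by blast
  obtain T where T: "0 \<le> T" "\<And>\<epsilon> p. 0 \<le> \<epsilon> \<Longrightarrow> FDRO_feasible P \<epsilon> p \<Longrightarrow> x_of p = x0 \<Longrightarrow>
       \<bar>tau_of p\<bar> \<le> T \<and> (\<forall>j. lam_of p $ j * \<epsilon> \<le> T) \<and> (\<forall>i j. 0 \<le> s_of p $ i $ j \<and> s_of p $ i $ j \<le> T)"
    using FDRO_feasible_bounds[OF gam, of x0] by metis
  define mk :: "real \<times> real \<times> (real ^ 'm) \<times> (real ^ 'm ^ 's) \<Rightarrow> ('n, 'm, 's) primal_vars"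
    where "mk d = \<lparr>x_of = x0, tau_of = fst (snd d), lam_of = fst (snd (snd d)),
      s_of = snd (snd (snd d))\<rparr>" for d
  \<comment> \<open>The radius is now a variable, so the CVaR constraint is bilinear in
    \<open>(\<epsilon>, lam)\<close> and the defining system is no longer linear; it is still
    closed.\<close>
  define K where "K = {d. \<epsilon>0 \<le> fst d \<and> fst d \<le> R \<and> FDRO_feasible P (fst d) (mk d)}"
  \<comment> \<open>With \<open>\<tau>\<close> moved out of the case distinction, continuity in
    \<open>\<tau>\<close> is visible to \<open>continuous_intros\<close>.\<close>
  have b_coef: "b_coef P x0 \<tau> k =
      (case k of None \<Rightarrow> 0 | Some k' \<Rightarrow> (Bmat P *v x0 - dvec P) $ k' / real CARD('m))
      - (case k of None \<Rightarrow> 0 | Some k' \<Rightarrow> 1 / real CARD('m)) * \<tau>" for \<tau> k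
    by (simp add: b_coef_def diff_divide_distrib split: option.split)
  have "closed K"
    unfolding K_def FDRO_feasible_def mk_def cvar_slack_def slack1_def slack2_def slack3_def
      primal_vars.simps b_coef
    by (intro closed_Collect_conj closed_Collect_all closed_Collect_le continuous_intros)
  moreover have "bounded K"
  proof (rule bounded_subset[OF bounded_closed_interval])
    show "K \<subseteq> {(\<epsilon>0, - T, 0, 0)..(R, T, \<chi> j. T / \<epsilon>0, \<chi> i j. T)}"
    proof
      fix d assume d: "d \<in> K"
      then have \<epsilon>: "\<epsilon>0 \<le> fst d" "fst d \<le> R" and F: "FDRO_feasible P (fst d) (mk d)"
        by (auto simp: K_def)
      have t: "\<bar>fst (snd d)\<bar> \<le> T" "\<And>j. fst (snd (snd d)) $ j * fst d \<le> T"
        "\<And>i j. 0 \<le> snd (snd (snd d)) $ i $ j \<and> snd (snd (snd d)) $ i $ j \<le> T"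
        using T(2)[OF _ F] \<epsilon> 0(1) by (auto simp: mk_def)
      have l: "0 \<le> fst (snd (snd d)) $ j" for j
        using F by (auto simp: FDRO_feasible_def mk_def)
      have "fst (snd (snd d)) $ j \<le> T / \<epsilon>0" for j
      proof -
        have "fst (snd (snd d)) $ j * \<epsilon>0 \<le> T"
          using mult_left_mono[OF \<epsilon>(1) l[of j]] t(2)[of j] by linarith
        then show ?thesis
          using 0(1) by (simp add: field_simps)
      qed
      with \<epsilon> t l show "d \<in> {(\<epsilon>0, - T, 0, 0)..(R, T, \<chi> j. T / \<epsilon>0, \<chi> i j. T)}"
        by (cases d) (auto simp: less_eq_vec_def)
    qed
  qed
  ultimately have "compact K"
    by (simp add: compact_eq_bounded_closed)
  have inK: "(\<epsilon>, tau_of p, lam_of p, s_of p) \<in> K" if "\<epsilon>0 \<le> \<epsilon>" "\<epsilon> \<le> R" "FDRO_feasible P \<epsilon> p" "x_of p = x0" for \<epsilon> p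
  proof -
    have "mk (\<epsilon>, tau_of p, lam_of p, s_of p) = p"
      using that(4) by (simp add: mk_def)
    with that show ?thesis by (simp add: K_def)
  qed
  then have "K \<noteq> {}"
    using 0 by blast
  have "continuous_on K fst"
    by (intro continuous_intros)
  then obtain d where d: "d \<in> K" "\<And>d'. d' \<in> K \<Longrightarrow> fst d' \<le> fst d"
    using continuous_attains_sup[OF \<open>compact K\<close> \<open>K \<noteq> {}\<close>] by metis
  show ?thesis
  proof (rule that[of "fst d" "mk d"])
    show "0 \<le> fst d" "fst d \<le> R" "FDRO_feasible P (fst d) (mk d)" "x_of (mk d) = x0"
      using d(1) 0(1) by (auto simp: K_def mk_def)
    show "\<epsilon>' \<le> fst d" if "\<epsilon>' \<le> R" "FDRO_feasible P \<epsilon>' p'" "x_of p' = x0" for \<epsilon>' p'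
    proof (cases "\<epsilon>0 \<le> \<epsilon>'")
      case True
      then show ?thesis
        using d(2)[OF inK[OF _ that]] by simp
    next
      \<comment> \<open>Radii cut off from \<open>K\<close> lie below \<open>\<epsilon>0\<close>,
        hence below the radius of every point of \<open>K\<close>.\<close>
      case False
      then show ?thesis
        using d(1) by (auto simp: K_def)
    qed
  qed
qed

section \<open>Existence and uniqueness of the recovered radius\<close>

theorem theorem1:
  fixes P :: "('n::finite, 'm::finite, 'oc::finite, 'cc::finite, 's::finite) dro_data"
    and x0 :: "real ^ 'n"
    and \<epsilon>_true :: real
  assumes "valid_data P"
    and "0 \<le> \<epsilon>_true"
    and "\<exists>p. FDRO_optimal P \<epsilon>_true p \<and> x_of p = x0"
  shows "\<exists>E\<ge>0. \<forall>\<epsilon>_bar>E.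
           (\<exists>v. IDRO_optimal P \<epsilon>_bar x0 v) \<and>
           (\<forall>v w. IDRO_optimal P \<epsilon>_bar x0 v \<and> IDRO_optimal P \<epsilon>_bar x0 w \<longrightarrow> fst v = fst w)"
\<comment> \<open>The true radius itself is the threshold: beyond it, \<open>\<epsilon>_true\<close>
  is an admissible value in the inverse problem.\<close>
proof (intro exI[of _ \<epsilon>_true] conjI allI impI)
  show "0 \<le> \<epsilon>_true" by fact
  fix \<epsilon>_bar assume bar: "\<epsilon>_true < \<epsilon>_bar"
  have gam: "0 < gam P" "gam P < 1"
    using assms(1) by (auto simp: valid_data_def)
  obtain p0 where p0: "FDRO_optimal P \<epsilon>_true p0" "x_of p0 = x0"
    using assms(3) by blast
  then have "FDRO_feasible P \<epsilon>_true p0"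
    by (simp add: FDRO_optimal_def is_arg_min_def)
  with p0 bar assms(2) obtain \<epsilon> p where \<epsilon>: "0 \<le> \<epsilon>" "\<epsilon> \<le> \<epsilon>_bar" "FDRO_feasible P \<epsilon> p" "x_of p = x0"
    and max: "\<And>\<epsilon>' p'. \<epsilon>' \<le> \<epsilon>_bar \<Longrightarrow> FDRO_feasible P \<epsilon>' p' \<Longrightarrow> x_of p' = x0 \<Longrightarrow> \<epsilon>' \<le> \<epsilon>"
    using FDRO_feasible_max_radius[OF gam assms(2), of \<epsilon>_bar x0] by (metis less_imp_le)
  \<comment> \<open>Optimality can only be carried upwards in the radius, so the maximal radius must
    be compared with the true one.\<close>
  have "\<epsilon>_true \<le> \<epsilon>"
    using max[OF _ \<open>FDRO_feasible P \<epsilon>_true p0\<close> p0(2)] bar by simp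
  then have "FDRO_optimal P \<epsilon> p"
    using FDRO_optimal_raise_radius[OF p0(1) _ gam(1) \<epsilon>(3)] \<epsilon>(4) p0(2) by simp
  then obtain q where "FDRO_KKT P \<epsilon> p q"
    by (rule FDRO_optimal_imp_KKT)
  with \<epsilon> have "IDRO_feasible P \<epsilon>_bar x0 (\<epsilon>, p, q)"
    by (simp add: IDRO_feasible_def)
  \<comment> \<open>All admissible radii lie below \<open>\<epsilon>_bar\<close>, so the smallest
    distance belongs to the largest radius. Maximality over primal feasible points covers all KKT
    points.\<close>
  moreover have "\<bar>\<epsilon> - \<epsilon>_bar\<bar> \<le> \<bar>\<epsilon>' - \<epsilon>_bar\<bar>" if "IDRO_feasible P \<epsilon>_bar x0 (\<epsilon>', p', q')" for \<epsilon>' p' q'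
    using max[of \<epsilon>' p'] that \<epsilon>(2) by (auto simp: IDRO_feasible_def FDRO_KKT_def)
  ultimately have "IDRO_optimal P \<epsilon>_bar x0 (\<epsilon>, p, q)"
    by (auto simp: IDRO_optimal_def is_arg_min_linorder)
  then show "\<exists>v. IDRO_optimal P \<epsilon>_bar x0 v" ..
next
  fix \<epsilon>_bar v w
  assume opt: "IDRO_optimal P \<epsilon>_bar x0 v \<and> IDRO_optimal P \<epsilon>_bar x0 w"
  then have "\<bar>fst v - \<epsilon>_bar\<bar> = \<bar>fst w - \<epsilon>_bar\<bar>"
    by (cases v; cases w) (auto simp: IDRO_optimal_def is_arg_min_linorder intro!: antisym)
  \<comment> \<open>Both radii lie on the same side of \<open>\<epsilon>_bar\<close>, so equal
    distances force equal radii.\<close>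
  moreover have "fst v \<le> \<epsilon>_bar" "fst w \<le> \<epsilon>_bar"
    using opt by (auto simp: IDRO_optimal_def is_arg_min_def IDRO_feasible_def)
  ultimately show "fst v = fst w"
    by simp
qed

end
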